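(* Suppose $K_l\subset\mathbb{R}^n$ are closed convex sets that have the SOSH property at $\bar x$ for $l\in\{1,\dots,r\}$. Let $K:=\bigcap_{l=1}^rK_l$, and suppose that $$\sum_{l=1}^r v_l=0,\ v_l\in N_{K_l}(\bar x)\quad\text{implies}\quad v_l=0\text{ for all }l\in\{1,\dots,r\}.$$ Then $K$ has the SOSH property at $\bar x$.
   Context: $N_C(x)=\{v\mid\langle v,y-x\rangle\le 0\ \forall y\in C\}$ is the normal cone of $C$ at $x\in C$, and $\mathbb{B}_\delta(\bar x)$ is the closed ball of radius $\delta$ about $\bar x$. A closed convex set $C\subset\mathbb{R}^n$ has the second order supporting hyperplane (SOSH) property at $\bar x\in C$ if there are $\delta>0$ and $M>0$ such that for any $x\in[\mathbb{B}_\delta(\bar x)\cap C]\setminus\{\bar x\}$ and any $v\in N_C(x)$ with $\|v\|=1$, we have $0\le-\langle v,\bar x-x\rangle\le M\|\bar x-x\|^2$. *)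

theory Defs
  imports "HOL-Analysis.Analysis"
begin

(* Meaningful for x in C only; no convention is imposed for x outside C. *)
definition normal_cone :: "'a::real_inner set \<Rightarrow> 'a \<Rightarrow> 'a set" where
  "normal_cone C x = {v. \<forall>y\<in>C. v \<bullet> (y - x) \<le> 0}"

(* Second order supporting hyperplane property of C at xbar. The standing requirements
   (C closed and convex, xbar in C) are part of the predicate. *)
definition SOSH :: "'a::euclidean_space set \<Rightarrow> 'a \<Rightarrow> bool" where
  "SOSH C xbar \<longleftrightarrow>
     closed C \<and> convex C \<and> xbar \<in> C \<and>
     (\<exists>\<delta>>0. \<exists>M>0. \<forall>x \<in> (cball xbar \<delta> \<inter> C) - {xbar}. \<forall>v \<in> normal_cone C x.
        norm v = 1 \<longrightarrow>
          0 \<le> - (v \<bullet> (xbar - x)) \<and> - (v \<bullet> (xbar - x)) \<le> M * (norm (xbar - x))\<^sup>2)"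

end

theory Submission
  imports Defs
begin

text \<open>
  Let \<open>A\<close> and \<open>B\<close> satisfy the qualification condition at \<open>xbar\<close>: no nonzero \<open>u\<close> is normal to \<open>A\<close>
  while \<open>- u\<close> is normal to \<open>B\<close>. A unit normal \<open>v\<close> of \<open>A \<inter> B\<close> at a point \<open>x\<close> near \<open>xbar\<close> then splits
  as \<open>v = a + b\<close> into normals of \<open>A\<close> and of \<open>B\<close> at the same \<open>x\<close>, and the norms of \<open>a\<close> and \<open>b\<close> are
  bounded by a constant that depends on neither \<open>x\<close> nor \<open>v\<close>. The quadratic estimates for \<open>A\<close> and \<open>B\<close>,
  which scale linearly in the normal vector, therefore add up to one for \<open>A \<inter> B\<close>.

  The uniform bound comes from the primal face of the qualification condition
  (\<open>qualification_imp_ball_subset_differences\<close>): the differences of points of \<open>A\<close> and \<open>B\<close> that lie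
  within distance 1 of \<open>xbar\<close> fill a ball of some radius \<open>\<epsilon>\<close> about \<open>0\<close>. Testing the separating
  functional that produces the splitting against this ball controls its norm by a multiple of
  \<open>1 / \<epsilon>\<close> (\<open>normal_cone_Int_decompose\<close>). This one ball serves all \<open>x\<close> within distance 1 of
  \<open>xbar\<close>, which is why the bound does not degrade as \<open>x\<close> varies.

  A finite family is treated one set at a time. The splitting at \<open>x = xbar\<close> has to be carried through
  the induction along with the SOSH property, because it is what turns the qualification
  condition for the family into the one for the pair formed by the intersection so far and the
  next set.
\<close>

section \<open>Normal cones and the homogeneous form of SOSH\<close>

lemma zero_in_normal_cone: "0 \<in> normal_cone C x"
  by (simp add: normal_cone_def)

lemma normal_cone_scale:
  assumes "v \<in> normal_cone C x" "0 \<le> c"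
  shows "c *\<^sub>R v \<in> normal_cone C x"
  using assms by (auto simp: normal_cone_def mult_nonneg_nonpos)

text \<open>Convexity lets any point of \<open>C\<close> be pulled towards \<open>x\<close> into the unit ball without changing the
  sign of the inner product.\<close>
lemma normal_cone_Int_cball:
  fixes C :: "'a::real_inner set"
  assumes "convex C" "x \<in> C"
  shows "normal_cone (C \<inter> cball x 1) x = normal_cone C x"
proof
  show "normal_cone C x \<subseteq> normal_cone (C \<inter> cball x 1) x"
    by (auto simp: normal_cone_def)
  show "normal_cone (C \<inter> cball x 1) x \<subseteq> normal_cone C x"
  proof
    fix u assume u: "u \<in> normal_cone (C \<inter> cball x 1) x"
    have "u \<bullet> (y - x) \<le> 0" if y: "y \<in> C" for y
    proof -
      define t where "t = 1 / (1 + norm (y - x))"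
      have t: "0 < t" "t \<le> 1" "t * norm (y - x) \<le> 1"
        by (auto simp: t_def divide_simps add_pos_nonneg)
      have "x + t *\<^sub>R (y - x) = (1 - t) *\<^sub>R x + t *\<^sub>R y"
        by (simp add: algebra_simps)
      also have "\<dots> \<in> C"
        using convexD[OF assms(1) assms(2) y, of "1 - t" t] t by simp
      finally have "x + t *\<^sub>R (y - x) \<in> C \<inter> cball x 1"
        using t by (simp add: dist_norm)
      hence "u \<bullet> ((x + t *\<^sub>R (y - x)) - x) \<le> 0"
        using u unfolding normal_cone_def by blast
      hence "t * (u \<bullet> (y - x)) \<le> 0" by simp
      thus ?thesis using t(1) by (simp add: mult_le_0_iff)
    qed
    thus "u \<in> normal_cone C x" by (simp add: normal_cone_def)
  qed
qed

lemma SOSH_closed_convex_mem: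
  assumes "SOSH C xbar"
  shows "closed C" "convex C" "xbar \<in> C"
  using assms unfolding SOSH_def by blast+

text \<open>Dropping the normalisation of \<open>v\<close> makes the estimate additive over splittings of a normal.\<close>
lemma SOSH_homogeneous:
  fixes C :: "'a::euclidean_space set"
  assumes "SOSH C xbar"
  obtains \<delta> M where "0 < \<delta>" "0 < M"
    "\<And>x v. x \<in> C \<Longrightarrow> norm (x - xbar) \<le> \<delta> \<Longrightarrow> v \<in> normal_cone C x \<Longrightarrow>
       v \<bullet> (x - xbar) \<le> M * norm v * (norm (x - xbar))\<^sup>2"
proof -
  from assms obtain \<delta> M where pos: "0 < \<delta>" "0 < M"
    and *: "\<And>x v. x \<in> (cball xbar \<delta> \<inter> C) - {xbar} \<Longrightarrow> v \<in> normal_cone C x \<Longrightarrow>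
        norm v = 1 \<Longrightarrow> - (v \<bullet> (xbar - x)) \<le> M * (norm (xbar - x))\<^sup>2"
    unfolding SOSH_def by blast
  have "v \<bullet> (x - xbar) \<le> M * norm v * (norm (x - xbar))\<^sup>2"
    if x: "x \<in> C" "norm (x - xbar) \<le> \<delta>" and v: "v \<in> normal_cone C x" for x v
  proof (cases "x = xbar \<or> v = 0")
    case True
    thus ?thesis by auto
  next
    case False
    let ?u = "(1 / norm v) *\<^sub>R v"
    have "?u \<in> normal_cone C x" using v by (intro normal_cone_scale) auto
    moreover have "norm ?u = 1" using False by simp
    moreover have "x \<in> (cball xbar \<delta> \<inter> C) - {xbar}"
      using x False by (simp add: dist_norm norm_minus_commute)
    ultimately have "- (?u \<bullet> (xbar - x)) \<le> M * (norm (xbar - x))\<^sup>2"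
      by (intro *)
    hence "?u \<bullet> (x - xbar) \<le> M * (norm (x - xbar))\<^sup>2"
      by (simp add: norm_minus_commute inner_diff_right algebra_simps)
    thus ?thesis using False by (simp add: field_simps)
  qed
  thus ?thesis using pos that by blast
qed

section \<open>The qualification condition in primal form\<close>

text \<open>Either \<open>S\<close> is flat and lies in a hyperplane, which passes through \<open>0\<close> because \<open>0 \<in> S\<close>, or it is
  the interior of \<open>S\<close> that is separated from \<open>0\<close>, and \<open>S\<close> lies in the closure of its interior.\<close>
lemma supporting_functional_at_zero:
  fixes S :: "'a::euclidean_space set"
  assumes "convex S" "0 \<in> S" "0 \<notin> interior S"
  obtains u where "u \<noteq> 0" "\<And>x. x \<in> S \<Longrightarrow> u \<bullet> x \<le> 0"
proof (cases "interior S = {}")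
  case True
  then obtain a b where ab: "a \<noteq> 0" "S \<subseteq> {x. a \<bullet> x = b}"
    using empty_interior_subset_hyperplane[OF assms(1)] by blast
  with assms(2) have "b = 0" by auto
  with ab show ?thesis by (intro that[of a]) auto
next
  case False
  obtain a where a: "a \<noteq> 0" "\<forall>x\<in>interior S. 0 \<le> a \<bullet> x"
    using separating_hyperplane_set_0[OF convex_interior[OF assms(1)] assms(3)] by blast
  have "closure (interior S) \<subseteq> {x. 0 \<le> a \<bullet> x}"
    using a(2) by (intro closure_minimal) (auto simp: closed_halfspace_ge)
  moreover have "S \<subseteq> closure (interior S)"
    using convex_closure_interior[OF assms(1) False] closure_subset by blast
  ultimately show ?thesis using a(1) by (intro that[of "- a"]) auto
qed

text \<open>If \<open>0\<close> were not interior to the set of differences, a functional supporting that set at \<open>0\<close>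
  would be normal to \<open>A\<close> with its negative normal to \<open>B\<close>.\<close>
lemma qualification_imp_ball_subset_differences:
  fixes A B :: "'a::euclidean_space set"
  assumes conv: "convex A" "convex B" and mem: "xbar \<in> A" "xbar \<in> B"
    and qual: "\<And>u. u \<in> normal_cone A xbar \<Longrightarrow> - u \<in> normal_cone B xbar \<Longrightarrow> u = 0"
  obtains \<epsilon> where "0 < \<epsilon>"
    "cball 0 \<epsilon> \<subseteq> {a - b |a b. a \<in> A \<inter> cball xbar 1 \<and> b \<in> B \<inter> cball xbar 1}"
proof -
  let ?A = "A \<inter> cball xbar 1" and ?B = "B \<inter> cball xbar 1"
  define S where "S = {a - b |a b. a \<in> ?A \<and> b \<in> ?B}"
  have S_eq: "S = (\<Union>a\<in>?A. \<Union>b\<in>?B. {a - b})"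
    unfolding S_def by blast
  have "convex S"
    unfolding S_eq by (intro convex_differences convex_Int conv convex_cball)
  moreover have memS: "xbar - b \<in> S" "a - xbar \<in> S" if "a \<in> ?A" "b \<in> ?B" for a b
    using that mem unfolding S_def by fastforce+
  have "0 \<in> S" using memS(1)[of xbar xbar] mem by simp
  moreover have "\<not> 0 \<notin> interior S"
  proof
    assume "0 \<notin> interior S"
    then obtain u where u: "u \<noteq> 0" "\<And>x. x \<in> S \<Longrightarrow> u \<bullet> x \<le> 0"
      using supporting_functional_at_zero \<open>convex S\<close> \<open>0 \<in> S\<close> by blast
    have "u \<in> normal_cone ?A xbar"
      using u(2) memS(2)[of _ xbar] mem by (auto simp: normal_cone_def)
    moreover have "- u \<in> normal_cone ?B xbar"
      using u(2) memS(1)[of xbar] mem by (fastforce simp: normal_cone_def inner_diff_right)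
    ultimately show False
      using qual u(1) conv mem by (simp add: normal_cone_Int_cball)
  qed
  ultimately obtain \<epsilon> where "0 < \<epsilon>" "cball 0 \<epsilon> \<subseteq> S"
    by (auto simp: mem_interior_cball)
  thus ?thesis using that unfolding S_def by blast
qed

section \<open>Bounded splitting of normals to an intersection\<close>

text \<open>Normality of \<open>v\<close> says that the value \<open>v \<bullet> (a - x)\<close> cannot be positive when the gap \<open>a - b\<close> is
  zero. So the convex set of pairs \<open>(a - b, s)\<close> with \<open>s \<le> v \<bullet> (a - x)\<close> misses the ray above the
  origin. A separating functional with nonzero last coordinate supplies the multiplier \<open>p\<close>, and
  absorption of the space by \<open>A - B\<close> excludes a vertical hyperplane.\<close>
lemma normal_cone_Int_multiplier:
  fixes A B :: "'a::euclidean_space set"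
  assumes conv: "convex A" "convex B" and x: "x \<in> A" "x \<in> B"
    and v: "v \<in> normal_cone (A \<inter> B) x"
    and \<epsilon>: "0 < \<epsilon>" "cball 0 \<epsilon> \<subseteq> {a - b |a b. a \<in> A \<and> b \<in> B}"
  obtains p where "\<And>a b. a \<in> A \<Longrightarrow> b \<in> B \<Longrightarrow> p \<bullet> (a - b) + v \<bullet> (a - x) \<le> 0"
proof -
  define S where "S = {(a - b, s) |a b s. a \<in> A \<and> b \<in> B \<and> s \<le> v \<bullet> (a - x)}"
  define T where "T = {0 :: 'a} \<times> {0 :: real <..}"
  have "convex S"
  proof (rule convexI)
    fix y z and s t :: real
    assume "y \<in> S" "z \<in> S" and st: "0 \<le> s" "0 \<le> t" "s + t = 1"
    then obtain a b \<sigma> a' b' \<sigma>' where y: "y = (a - b, \<sigma>)" "a \<in> A" "b \<in> B" "\<sigma> \<le> v \<bullet> (a - x)"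
      and z: "z = (a' - b', \<sigma>')" "a' \<in> A" "b' \<in> B" "\<sigma>' \<le> v \<bullet> (a' - x)"
      by (auto simp: S_def)
    let ?a = "s *\<^sub>R a + t *\<^sub>R a'" and ?b = "s *\<^sub>R b + t *\<^sub>R b'"
    have mem: "?a \<in> A" "?b \<in> B"
      using convexD[OF conv(1) y(2) z(2) st] convexD[OF conv(2) y(3) z(3) st] .
    have "s *\<^sub>R (a - x) + t *\<^sub>R (a' - x) = ?a - (s + t) *\<^sub>R x"
      by (simp add: algebra_simps)
    hence eq: "?a - x = s *\<^sub>R (a - x) + t *\<^sub>R (a' - x)"
      using st by simp
    have "s * \<sigma> + t * \<sigma>' \<le> s * (v \<bullet> (a - x)) + t * (v \<bullet> (a' - x))"
      using y(4) z(4) st by (intro add_mono mult_left_mono)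
    also have "\<dots> = v \<bullet> (?a - x)"
      unfolding eq by (simp add: inner_add_right)
    finally have "s * \<sigma> + t * \<sigma>' \<le> v \<bullet> (?a - x)" .
    moreover have "s *\<^sub>R y + t *\<^sub>R z = (?a - ?b, s * \<sigma> + t * \<sigma>')"
      by (simp add: y z algebra_simps)
    ultimately show "s *\<^sub>R y + t *\<^sub>R z \<in> S"
      using mem unfolding S_def by blast
  qed
  moreover have "convex T"
    unfolding T_def by (intro convex_Times) auto
  moreover have "S \<inter> T = {}"
  proof -
    have False if "(w, s) \<in> S" "(w, s) \<in> T" for w s
    proof -
      obtain a where "a \<in> A \<inter> B" "s \<le> v \<bullet> (a - x)" "0 < s"
        using \<open>(w, s) \<in> S\<close> \<open>(w, s) \<in> T\<close> unfolding S_def T_def by auto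
      moreover have "v \<bullet> (a - x) \<le> 0"
        using v \<open>a \<in> A \<inter> B\<close> unfolding normal_cone_def by blast
      ultimately show False by simp
    qed
    thus ?thesis by auto
  qed
  moreover have "(0, 0) \<in> S"
    unfolding S_def using x by force
  moreover have "(0, 1) \<in> T"
    by (simp add: T_def)
  ultimately obtain f \<beta> where f: "f \<noteq> 0" "\<forall>y\<in>S. f \<bullet> y \<le> \<beta>" "\<forall>y\<in>T. f \<bullet> y \<ge> \<beta>"
    using separating_hyperplane_sets[of S T] by blast
  obtain p q where f_eq: "f = (p, q)" by fastforce
  have \<beta>_le: "\<beta> \<le> q * t" if "0 < t" for t
    using f(3) that by (auto simp: T_def f_eq)
  have "0 \<le> \<beta>" using bspec[OF f(2) \<open>(0, 0) \<in> S\<close>] by (simp add: f_eq)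
  with \<beta>_le[of 1] have q: "0 \<le> q" by simp
  have "\<beta> \<le> 0"
  proof (rule ccontr)
    assume "\<not> \<beta> \<le> 0"
    hence "0 < \<beta>" by simp
    have "0 < q" using \<beta>_le[of 1] \<open>0 < \<beta>\<close> by simp
    thus False using \<beta>_le[of "\<beta> / (2 * q)"] \<open>0 < \<beta>\<close> by (simp add: field_simps)
  qed
  have sep: "p \<bullet> (a - b) + q * (v \<bullet> (a - x)) \<le> 0" if "a \<in> A" "b \<in> B" for a b
  proof -
    have "(a - b, v \<bullet> (a - x)) \<in> S" using that unfolding S_def by blast
    thus ?thesis using f(2) \<open>\<beta> \<le> 0\<close> by (fastforce simp: f_eq)
  qed
  have "q \<noteq> 0"
  proof
    assume "q = 0"
    hence "p \<noteq> 0" using f(1) by (auto simp: f_eq zero_prod_def)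
    have "(\<epsilon> / norm p) *\<^sub>R p \<in> cball 0 \<epsilon>"
      using \<epsilon>(1) \<open>p \<noteq> 0\<close> by simp
    then obtain a b where ab: "a \<in> A" "b \<in> B" "(\<epsilon> / norm p) *\<^sub>R p = a - b"
      using \<epsilon>(2) by blast
    have "p \<bullet> ((\<epsilon> / norm p) *\<^sub>R p) \<le> 0"
      using sep[OF ab(1,2)] \<open>q = 0\<close> by (simp add: ab(3))
    moreover have "0 < p \<bullet> ((\<epsilon> / norm p) *\<^sub>R p)"
      using \<epsilon>(1) \<open>p \<noteq> 0\<close> by simp
    ultimately show False by simp
  qed
  with q have "0 < q" by simp
  show ?thesis
  proof (rule that[of "(1 / q) *\<^sub>R p"])
    fix a b assume "a \<in> A" "b \<in> B"
    thus "((1 / q) *\<^sub>R p) \<bullet> (a - b) + v \<bullet> (a - x) \<le> 0"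
      using sep[of a b] \<open>0 < q\<close> by (simp add: field_simps)
  qed
qed

text \<open>For a multiplier \<open>p\<close> of \<open>v\<close>, the two summands are \<open>p + v\<close> (put \<open>b = x\<close> in the multiplier
  inequality) and \<open>- p\<close> (put \<open>a = x\<close>). The bound on \<open>p\<close> comes from a pair whose difference is the
  vector of length \<open>\<epsilon>\<close> in direction \<open>p\<close>: both \<open>x\<close> and the point of \<open>A\<close> in that pair are within
  distance 1 of \<open>xbar\<close>, so \<open>\<epsilon> * norm p\<close> is at most twice the norm of \<open>v\<close>.\<close>
lemma normal_cone_Int_decompose:
  fixes A B :: "'a::euclidean_space set"
  assumes conv: "convex A" "convex B" and mem: "xbar \<in> A" "xbar \<in> B"
    and qual: "\<And>u. u \<in> normal_cone A xbar \<Longrightarrow> - u \<in> normal_cone B xbar \<Longrightarrow> u = 0"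
  obtains c where "0 < c"
    "\<And>x v. x \<in> A \<inter> B \<Longrightarrow> norm (x - xbar) \<le> 1 \<Longrightarrow> v \<in> normal_cone (A \<inter> B) x \<Longrightarrow>
       \<exists>a\<in>normal_cone A x. \<exists>b\<in>normal_cone B x.
         v = a + b \<and> norm a \<le> c * norm v \<and> norm b \<le> c * norm v"
proof -
  obtain \<epsilon> where \<epsilon>: "0 < \<epsilon>"
    and ball: "cball 0 \<epsilon> \<subseteq> {a - b |a b. a \<in> A \<inter> cball xbar 1 \<and> b \<in> B \<inter> cball xbar 1}"
    using qualification_imp_ball_subset_differences[OF conv mem qual] by blast
  define c where "c = 2 / \<epsilon> + 1"
  have "0 < c" using \<epsilon> by (simp add: c_def add_pos_pos)
  have split: "\<exists>a\<in>normal_cone A x. \<exists>b\<in>normal_cone B x.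
         v = a + b \<and> norm a \<le> c * norm v \<and> norm b \<le> c * norm v"
    if x: "x \<in> A \<inter> B" "norm (x - xbar) \<le> 1" and v: "v \<in> normal_cone (A \<inter> B) x" for x v
  proof -
    have "cball 0 \<epsilon> \<subseteq> {a - b |a b. a \<in> A \<and> b \<in> B}"
      using ball by blast
    then obtain p where p: "\<And>a b. a \<in> A \<Longrightarrow> b \<in> B \<Longrightarrow> p \<bullet> (a - b) + v \<bullet> (a - x) \<le> 0"
      using normal_cone_Int_multiplier[OF conv _ _ v \<epsilon>] x(1) by blast
    have "(p + v) \<bullet> (a - x) \<le> 0" if "a \<in> A" for a
      using p[OF that, of x] x(1) by (simp add: inner_add_left)
    hence a: "p + v \<in> normal_cone A x" by (simp add: normal_cone_def)
    have "(- p) \<bullet> (b - x) \<le> 0" if "b \<in> B" for b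
      using p[OF _ that, of x] x(1) by (simp add: inner_diff_right)
    hence b: "- p \<in> normal_cone B x" by (simp add: normal_cone_def)
    have p_le: "norm p \<le> 2 / \<epsilon> * norm v"
    proof (cases "p = 0")
      case True
      thus ?thesis using \<epsilon> by simp
    next
      case False
      have "(\<epsilon> / norm p) *\<^sub>R p \<in> cball 0 \<epsilon>" using \<epsilon> False by simp
      then obtain a b where ab: "a \<in> A" "b \<in> B" "norm (a - xbar) \<le> 1"
          "(\<epsilon> / norm p) *\<^sub>R p = a - b"
        using ball by (force simp: dist_norm norm_minus_commute)
      have "p \<bullet> (a - b) = \<epsilon> * norm p"
        unfolding ab(4)[symmetric] using False
        by (simp add: dot_square_norm power2_eq_square)
      hence "\<epsilon> * norm p \<le> v \<bullet> (x - a)"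
        using p[OF ab(1,2)] by (simp add: inner_diff_right)
      also have "\<dots> \<le> norm v * norm (x - a)" by (rule norm_cauchy_schwarz)
      also have "\<dots> \<le> norm v * 2"
        using norm_triangle_ineq4[of "x - xbar" "a - xbar"] x(2) ab(3)
        by (intro mult_left_mono) auto
      finally show ?thesis using \<epsilon> by (simp add: field_simps)
    qed
    have "norm (p + v) \<le> c * norm v"
      using norm_triangle_ineq[of p v] p_le by (simp add: c_def algebra_simps)
    moreover have "norm (- p) \<le> c * norm v"
      using p_le norm_ge_zero[of v] unfolding norm_minus_cancel c_def distrib_right by linarith
    moreover have "v = (p + v) + (- p)" by simp
    ultimately show ?thesis
      by (intro bexI[OF _ a] bexI[OF _ b] conjI)
  qed
  show ?thesis using \<open>0 < c\<close> split by (rule that)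
qed

section \<open>SOSH for intersections\<close>

lemma SOSH_Int:
  fixes A B :: "'a::euclidean_space set"
  assumes A: "SOSH A xbar" and B: "SOSH B xbar"
    and qual: "\<And>u. u \<in> normal_cone A xbar \<Longrightarrow> - u \<in> normal_cone B xbar \<Longrightarrow> u = 0"
  shows "SOSH (A \<inter> B) xbar"
proof -
  have sets: "closed A" "closed B" "convex A" "convex B" "xbar \<in> A" "xbar \<in> B"
    using A B by (simp_all add: SOSH_closed_convex_mem)
  obtain \<delta>1 M1 where 1: "0 < \<delta>1" "0 < M1"
    "\<And>x v. x \<in> A \<Longrightarrow> norm (x - xbar) \<le> \<delta>1 \<Longrightarrow> v \<in> normal_cone A x \<Longrightarrow>
       v \<bullet> (x - xbar) \<le> M1 * norm v * (norm (x - xbar))\<^sup>2"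
    using SOSH_homogeneous[OF A] by blast
  obtain \<delta>2 M2 where 2: "0 < \<delta>2" "0 < M2"
    "\<And>x v. x \<in> B \<Longrightarrow> norm (x - xbar) \<le> \<delta>2 \<Longrightarrow> v \<in> normal_cone B x \<Longrightarrow>
       v \<bullet> (x - xbar) \<le> M2 * norm v * (norm (x - xbar))\<^sup>2"
    using SOSH_homogeneous[OF B] by blast
  obtain c where c: "0 < c"
    "\<And>x v. x \<in> A \<inter> B \<Longrightarrow> norm (x - xbar) \<le> 1 \<Longrightarrow> v \<in> normal_cone (A \<inter> B) x \<Longrightarrow>
       \<exists>a\<in>normal_cone A x. \<exists>b\<in>normal_cone B x.
         v = a + b \<and> norm a \<le> c * norm v \<and> norm b \<le> c * norm v"
    using normal_cone_Int_decompose[OF sets(3-6) qual] by blast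
  define \<delta> where "\<delta> = min 1 (min \<delta>1 \<delta>2)"
  define M where "M = M1 * c + M2 * c"
  have "0 < \<delta>" "0 < M" using 1(1,2) 2(1,2) c(1) by (simp_all add: \<delta>_def M_def add_pos_pos)
  moreover have "0 \<le> - (v \<bullet> (xbar - x)) \<and> - (v \<bullet> (xbar - x)) \<le> M * (norm (xbar - x))\<^sup>2"
    if x: "x \<in> (cball xbar \<delta> \<inter> (A \<inter> B)) - {xbar}" and v: "v \<in> normal_cone (A \<inter> B) x"
      and nv: "norm v = 1" for x v
  proof
    show "0 \<le> - (v \<bullet> (xbar - x))" using v sets by (auto simp: normal_cone_def)
    have d: "norm (x - xbar) \<le> 1" "norm (x - xbar) \<le> \<delta>1" "norm (x - xbar) \<le> \<delta>2"
      using x by (auto simp: \<delta>_def dist_norm norm_minus_commute)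
    have mem: "x \<in> A \<inter> B" "x \<in> A" "x \<in> B" using x by auto
    obtain a b where ab: "a \<in> normal_cone A x" "b \<in> normal_cone B x" "v = a + b"
        "norm a \<le> c" "norm b \<le> c"
      using c(2)[OF mem(1) d(1) v, unfolded nv mult_1_right] by blast
    let ?n = "(norm (x - xbar))\<^sup>2"
    have "a \<bullet> (x - xbar) \<le> M1 * norm a * ?n" by (rule 1(3)[OF mem(2) d(2) ab(1)])
    also have "\<dots> \<le> M1 * c * ?n" using 1(2) ab by (intro mult_right_mono mult_left_mono) auto
    finally have a_le: "a \<bullet> (x - xbar) \<le> M1 * c * ?n" .
    have "b \<bullet> (x - xbar) \<le> M2 * norm b * ?n" by (rule 2(3)[OF mem(3) d(3) ab(2)])
    also have "\<dots> \<le> M2 * c * ?n" using 2(2) ab by (intro mult_right_mono mult_left_mono) auto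
    finally have "b \<bullet> (x - xbar) \<le> M2 * c * ?n" .
    with a_le have "v \<bullet> (x - xbar) \<le> M * ?n"
      by (simp add: ab(3) M_def inner_add_left distrib_right)
    thus "- (v \<bullet> (xbar - x)) \<le> M * (norm (xbar - x))\<^sup>2"
      by (simp add: norm_minus_commute inner_diff_right)
  qed
  ultimately show ?thesis
    unfolding SOSH_def using sets by (blast intro: closed_Int convex_Int)
qed

text \<open>The second conclusion strengthens the induction: a normal \<open>u\<close> of the partial intersection,
  with \<open>- u\<close> normal to the next set, is resolved into normals of the individual sets, to which the
  qualification condition of the family applies.\<close>
lemma SOSH_INT:
  fixes K :: "'i \<Rightarrow> 'a::euclidean_space set"
  assumes "finite I" "\<And>l. l \<in> I \<Longrightarrow> SOSH (K l) xbar"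
    and "\<And>v. (\<Sum>l\<in>I. v l) = 0 \<Longrightarrow> \<forall>l\<in>I. v l \<in> normal_cone (K l) xbar \<Longrightarrow> \<forall>l\<in>I. v l = 0"
  shows "SOSH (\<Inter>l\<in>I. K l) xbar \<and>
    (\<forall>u\<in>normal_cone (\<Inter>l\<in>I. K l) xbar.
       \<exists>v. u = (\<Sum>l\<in>I. v l) \<and> (\<forall>l\<in>I. v l \<in> normal_cone (K l) xbar))"
  using assms
proof (induction I rule: finite_induct)
  case empty
  have "v = 0" if "v \<in> normal_cone UNIV x" for v x :: 'a
  proof -
    have "v \<bullet> ((x + v) - x) \<le> 0" using that unfolding normal_cone_def by blast
    thus ?thesis by (simp add: inner_gt_zero_iff flip: not_less)
  qed
  hence "normal_cone UNIV x = {0}" for x :: 'a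
    using zero_in_normal_cone by blast
  thus ?case by (auto simp: SOSH_def intro: exI[of _ "1::real"])
next
  case (insert i F)
  let ?L = "\<Inter>l\<in>F. K l"
  \<comment> \<open>The family condition in the form used below: a candidate splitting of zero over \<open>insert i F\<close>
    consists of a family on \<open>F\<close> and one vector at \<open>i\<close>.\<close>
  have qual: "w = 0 \<and> (\<forall>l\<in>F. v l = 0)"
    if "(\<Sum>l\<in>F. v l) + w = 0" "\<forall>l\<in>F. v l \<in> normal_cone (K l) xbar"
      "w \<in> normal_cone (K i) xbar" for v w
  proof -
    have eq: "(\<Sum>l\<in>F. (v(i := w)) l) = (\<Sum>l\<in>F. v l)"
      using insert.hyps by (intro sum.cong) auto
    have "\<forall>l\<in>insert i F. (v(i := w)) l = 0"
    proof (rule insert.prems(2))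
      show "(\<Sum>l\<in>insert i F. (v(i := w)) l) = 0"
        unfolding sum.insert[OF insert.hyps] eq using that(1) by (simp add: add.commute)
      show "\<forall>l\<in>insert i F. (v(i := w)) l \<in> normal_cone (K l) xbar"
        using that(2,3) by simp
    qed
    thus ?thesis using insert.hyps by (auto split: if_splits)
  qed
  have IH: "SOSH ?L xbar \<and> (\<forall>u\<in>normal_cone ?L xbar.
       \<exists>v. u = (\<Sum>l\<in>F. v l) \<and> (\<forall>l\<in>F. v l \<in> normal_cone (K l) xbar))"
  proof (rule insert.IH)
    show "SOSH (K l) xbar" if "l \<in> F" for l using insert.prems(1) that by simp
    show "\<forall>l\<in>F. v l = 0"
      if "(\<Sum>l\<in>F. v l) = 0" "\<forall>l\<in>F. v l \<in> normal_cone (K l) xbar" for v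
      using qual[of v 0] that by (simp add: zero_in_normal_cone)
  qed
  note L = conjunct1[OF IH] and split = bspec[OF conjunct2[OF IH]]
  have Ki: "SOSH (K i) xbar" using insert.prems(1) by simp
  have pair: "u = 0" if u: "u \<in> normal_cone ?L xbar" "- u \<in> normal_cone (K i) xbar" for u
  proof -
    obtain v where v: "u = (\<Sum>l\<in>F. v l) \<and> (\<forall>l\<in>F. v l \<in> normal_cone (K l) xbar)"
      using split[OF u(1)] by (rule exE)
    have "(\<Sum>l\<in>F. v l) + - u = 0"
      unfolding conjunct1[OF v, symmetric] by simp
    hence "- u = 0" using qual[OF _ conjunct2[OF v] u(2)] by blast
    thus ?thesis by simp
  qed
  have Int_eq: "(\<Inter>l\<in>insert i F. K l) = ?L \<inter> K i" by auto
  have "\<exists>v. u = (\<Sum>l\<in>insert i F. v l) \<and> (\<forall>l\<in>insert i F. v l \<in> normal_cone (K l) xbar)"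
    if u: "u \<in> normal_cone (?L \<inter> K i) xbar" for u
  proof -
    have sets: "convex ?L" "convex (K i)" "xbar \<in> ?L" "xbar \<in> K i"
      by (rule SOSH_closed_convex_mem[OF L] SOSH_closed_convex_mem[OF Ki])+
    have "\<exists>a\<in>normal_cone ?L xbar. \<exists>b\<in>normal_cone (K i) xbar. u = a + b"
    proof (rule normal_cone_Int_decompose[OF sets pair])
      fix c
      assume c: "\<And>x v. x \<in> ?L \<inter> K i \<Longrightarrow> norm (x - xbar) \<le> 1 \<Longrightarrow>
        v \<in> normal_cone (?L \<inter> K i) x \<Longrightarrow>
        \<exists>a\<in>normal_cone ?L x. \<exists>b\<in>normal_cone (K i) x.
          v = a + b \<and> norm a \<le> c * norm v \<and> norm b \<le> c * norm v"
      show ?thesis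
        using c[OF IntI[OF sets(3,4)] _ u] by auto
    qed
    then obtain a b where ab: "a \<in> normal_cone ?L xbar" "b \<in> normal_cone (K i) xbar" "u = a + b"
      by blast
    obtain v where v: "a = (\<Sum>l\<in>F. v l) \<and> (\<forall>l\<in>F. v l \<in> normal_cone (K l) xbar)"
      using split[OF ab(1)] by (rule exE)
    have "(\<Sum>l\<in>F. (v(i := b)) l) = (\<Sum>l\<in>F. v l)"
      using insert.hyps by (intro sum.cong) auto
    hence "u = (\<Sum>l\<in>insert i F. (v(i := b)) l)"
      unfolding sum.insert[OF insert.hyps] ab(3) conjunct1[OF v] by (simp add: add.commute)
    moreover have "\<forall>l\<in>insert i F. (v(i := b)) l \<in> normal_cone (K l) xbar"
      using conjunct2[OF v] ab(2) by simp
    ultimately show ?thesis by (intro exI[of _ "v(i := b)"] conjI)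
  qed
  thus ?case
    unfolding Int_eq by (intro conjI ballI SOSH_Int[OF L Ki pair])
qed

theorem proposition3p7:
  fixes K :: "nat \<Rightarrow> (real ^ 'n) set" and xbar :: "real ^ 'n" and r :: nat
  assumes "\<And>l. l \<in> {1..r} \<Longrightarrow> closed (K l)"
    and "\<And>l. l \<in> {1..r} \<Longrightarrow> convex (K l)"
    and "\<And>l. l \<in> {1..r} \<Longrightarrow> SOSH (K l) xbar"
    and "\<And>v :: nat \<Rightarrow> real ^ 'n.
           (\<Sum>l\<in>{1..r}. v l) = 0 \<Longrightarrow> (\<forall>l\<in>{1..r}. v l \<in> normal_cone (K l) xbar) \<Longrightarrow>
           \<forall>l\<in>{1..r}. v l = 0"
  shows "SOSH (\<Inter>l\<in>{1..r}. K l) xbar"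
  by (rule conjunct1[OF SOSH_INT[OF finite_atLeastAtMost assms(3,4)]])

end
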